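(* For every graph $G=(V,E)$, every positive integer $k$, and every $w\in\mathbb{R}_+^V$, $$\alpha_k(G,w)\leq\theta_k(G,w).$$
   Context: Graphs are finite and simple. For a positive integer $k$ and $w\in\mathbb{R}_+^V$, $$\alpha_k(G,w)=\max\Big\{\sum_{i\in U}w_i : U\subseteq V,\ G[U]\text{ is }k\text{-colorable}\Big\},$$ where $G[U]$ is the subgraph induced by $U$. The theta body $\mathrm{TH}(G)$ is the set of $x\in\mathbb{R}^V$ for which there exists a real symmetric $V\times V$ matrix $Y$ with $\operatorname{diag}(Y)=x$ (the vector of diagonal entries), $Y_{ij}=0$ for all $ij\in E$, and $\begin{pmatrix}1&x^\top\\ x&Y\end{pmatrix}$ positive semidefinite. It is a convex subset of $\mathbb{R}_+^V$. For real $k\ge0$, define $$\mathrm{TH}_k(G)=k\,\mathrm{TH}(G)\cap[0,1]^V,\qquad \theta_k(G,w)=\max\{\langle w,x\rangle : x\in\mathrm{TH}_k(G)\}\quad(w\in\mathbb{R}_+^V).$$ *)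

theory Defs
  imports
    Complex_Main
    "HOL-Library.FuncSet"
    "Graph_Theory.Digraph_Component"
begin

text \<open>
  Finite simple graphs are the symmetric, loop-free digraphs without multiple arcs of the locale
  \<open>graph\<close>; an edge \<open>ij\<close> is a pair \<open>(i, j)\<close>, together with \<open>(j, i)\<close>, in \<open>arcs_ends G\<close>.
  For a set \<open>V\<close> of vertices, the space of real vectors indexed by \<open>V\<close> is \<open>V \<rightarrow>\<^sub>E UNIV\<close>, the
  functions with the fixed value \<open>undefined\<close> outside \<open>V\<close>.
\<close>

definition k_colorable :: "nat \<Rightarrow> ('a, 'b) pre_digraph \<Rightarrow> bool" where
  "k_colorable k G \<longleftrightarrow>
     (\<exists>c \<in> verts G \<rightarrow> {..<k}. \<forall>(i, j) \<in> arcs_ends G. c i \<noteq> c j)"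

definition alpha :: "nat \<Rightarrow> ('a, 'b) pre_digraph \<Rightarrow> ('a \<Rightarrow> real) \<Rightarrow> real" where
  "alpha k G w = Max {\<Sum>i\<in>U. w i | U. U \<subseteq> verts G \<and> k_colorable k (G \<restriction> U)}"

definition symmetric_on :: "'i set \<Rightarrow> ('i \<Rightarrow> 'i \<Rightarrow> real) \<Rightarrow> bool" where
  "symmetric_on I M \<longleftrightarrow> (\<forall>i\<in>I. \<forall>j\<in>I. M i j = M j i)"

definition psd_on :: "'i set \<Rightarrow> ('i \<Rightarrow> 'i \<Rightarrow> real) \<Rightarrow> bool" where
  "psd_on I M \<longleftrightarrow> symmetric_on I M \<and> (\<forall>z. 0 \<le> (\<Sum>i\<in>I. \<Sum>j\<in>I. z i * M i j * z j))"

text \<open>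
  The block matrix with first row \<open>(1, x\<^sup>T)\<close> and second row \<open>(x, Y)\<close>: the index \<open>None\<close> stands
  for the additional row and column.
\<close>

fun bordered :: "('a \<Rightarrow> real) \<Rightarrow> ('a \<Rightarrow> 'a \<Rightarrow> real) \<Rightarrow> 'a option \<Rightarrow> 'a option \<Rightarrow> real" where
  "bordered x Y None None = 1"
| "bordered x Y None (Some j) = x j"
| "bordered x Y (Some i) None = x i"
| "bordered x Y (Some i) (Some j) = Y i j"

definition theta_body :: "('a, 'b) pre_digraph \<Rightarrow> ('a \<Rightarrow> real) set" where
  "theta_body G = {x \<in> verts G \<rightarrow>\<^sub>E UNIV. \<exists>Y.
     symmetric_on (verts G) Y \<and>
     (\<forall>i\<in>verts G. Y i i = x i) \<and>
     (\<forall>(i, j)\<in>arcs_ends G. Y i j = 0) \<and>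
     psd_on (insert None (Some ` verts G)) (bordered x Y)}"

definition theta_body_k :: "real \<Rightarrow> ('a, 'b) pre_digraph \<Rightarrow> ('a \<Rightarrow> real) set" where
  "theta_body_k k G =
     (\<lambda>x. \<lambda>i\<in>verts G. k * x i) ` theta_body G \<inter> (verts G \<rightarrow>\<^sub>E {0..1})"

text \<open>
  The maximum is the greatest element of the set of values, and not merely its supremum; the set
  is in general infinite, so \<open>Max\<close> is not applicable.
\<close>

definition theta :: "real \<Rightarrow> ('a, 'b) pre_digraph \<Rightarrow> ('a \<Rightarrow> real) \<Rightarrow> real" where
  "theta k G w = (GREATEST m. m \<in> (\<lambda>x. \<Sum>i\<in>verts G. w i * x i) ` theta_body_k k G)"

end

theory Submission
  imports Defs "HOL-Analysis.Function_Topology"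
begin

text \<open>
  Let \<open>U\<close> carry a proper colouring with the \<open>k\<close> classes \<open>U\<^sub>0, \<dots>, U\<^sub>k\<^sub>-\<^sub>1\<close>, some of them possibly
  empty, and let \<open>\<chi>\<^sub>t\<close> be the indicator vector of \<open>U\<^sub>t\<close>.  The matrix
  \<open>Y = (1/k) \<Sum>\<^sub>t \<chi>\<^sub>t \<chi>\<^sub>t\<^sup>T\<close> has diagonal \<open>\<chi>\<^sub>U / k\<close> and vanishes on the edges, because every class is
  stable.  Bordered by its diagonal it is the average of the rank-one matrices
  \<open>(1, \<chi>\<^sub>t) (1, \<chi>\<^sub>t)\<^sup>T\<close>, hence positive semidefinite.  So \<open>\<chi>\<^sub>U / k\<close> lies in the theta body, and
  \<open>\<chi>\<^sub>U\<close>, whose weight is that of \<open>U\<close>, is feasible for \<open>\<theta>\<^sub>k\<close> (\<open>indicator_in_theta_body_k\<close>).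

  This bounds \<open>\<alpha>\<^sub>k\<close> by \<open>\<theta>\<^sub>k\<close> once the maximum in the definition of \<open>\<theta>\<^sub>k\<close> is known to be attained
  (\<open>theta_upper_bound\<close>).  A feasible point is \<open>k\<close> times the diagonal of a witness matrix \<open>Y\<close>, so the
  objective is a continuous function of \<open>Y\<close>.  Positive semidefiniteness of the bordered matrix forces
  all entries of \<open>Y\<close> into \<open>[-1, 1]\<close>, and all constraints on \<open>Y\<close> are closed, so the witness matrices
  form a compact set.
\<close>

section \<open>Positive semidefinite matrices\<close>

lemma psd_on_cong:
  assumes "\<And>p q. p \<in> I \<Longrightarrow> q \<in> I \<Longrightarrow> M p q = N p q"
  shows "psd_on I M \<longleftrightarrow> psd_on I N"
proof -
  have "(\<Sum>p\<in>I. \<Sum>q\<in>I. z p * M p q * z q) = (\<Sum>p\<in>I. \<Sum>q\<in>I. z p * N p q * z q)" for z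
    by (intro sum.cong refl) (simp add: assms)
  then show ?thesis
    unfolding psd_on_def symmetric_on_def by (simp add: assms)
qed

lemma psd_on_sum_rank_one:
  assumes a: "\<And>t. t \<in> T \<Longrightarrow> 0 \<le> a t"
    and M: "\<And>p q. p \<in> I \<Longrightarrow> q \<in> I \<Longrightarrow> M p q = (\<Sum>t\<in>T. a t * (v t p * v t q))"
  shows "psd_on I M"
  unfolding psd_on_def
proof (intro conjI allI)
  show "symmetric_on I M"
    unfolding symmetric_on_def by (simp add: M mult.commute)
  fix z
  have "(\<Sum>p\<in>I. \<Sum>q\<in>I. z p * M p q * z q)
      = (\<Sum>p\<in>I. \<Sum>q\<in>I. \<Sum>t\<in>T. a t * ((z p * v t p) * (z q * v t q)))"
    by (intro sum.cong refl) (simp add: M sum_distrib_left sum_distrib_right mult_ac)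
  also have "\<dots> = (\<Sum>p\<in>I. \<Sum>t\<in>T. \<Sum>q\<in>I. a t * ((z p * v t p) * (z q * v t q)))"
    by (intro sum.cong refl sum.swap)
  also have "\<dots> = (\<Sum>t\<in>T. \<Sum>p\<in>I. \<Sum>q\<in>I. a t * ((z p * v t p) * (z q * v t q)))"
    by (rule sum.swap)
  also have "\<dots> = (\<Sum>t\<in>T. a t * (\<Sum>p\<in>I. z p * v t p)\<^sup>2)"
    unfolding power2_eq_square sum_product unfolding sum_distrib_left by (rule refl)
  also have "\<dots> \<ge> 0"
    by (intro sum_nonneg mult_nonneg_nonneg a) auto
  finally show "0 \<le> (\<Sum>p\<in>I. \<Sum>q\<in>I. z p * M p q * z q)" .
qed

text \<open>
  The form is nonnegative at \<open>e\<^sub>p + e\<^sub>q\<close> and at \<open>e\<^sub>p - e\<^sub>q\<close>.  This weak version of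
  \<open>M\<^sub>p\<^sub>q\<^sup>2 \<le> M\<^sub>p\<^sub>p M\<^sub>q\<^sub>q\<close> suffices for boundedness.
\<close>

lemma psd_on_entry_bound:
  assumes psd: "psd_on I M" and fin: "finite I" and p: "p \<in> I" and q: "q \<in> I"
  shows "2 * \<bar>M p q\<bar> \<le> M p p + M q q"
proof -
  have sym: "M q p = M p q"
    using psd p q by (auto simp: psd_on_def symmetric_on_def)
  have form: "0 \<le> M p p + 2 * b * M p q + b\<^sup>2 * M q q" for b :: real
  proof -
    let ?z = "\<lambda>r. (if r = p then 1 else 0) + b * (if r = q then 1 else 0)"
    have row: "(\<Sum>s\<in>I. ?z r * M r s * ?z s) = ?z r * (M r p + b * M r q)" for r
    proof -
      have "(\<Sum>s\<in>I. ?z r * M r s * ?z s)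
          = (\<Sum>s\<in>I. (if s = p then ?z r * M r s else 0) + (if s = q then b * ?z r * M r s else 0))"
        by (intro sum.cong refl) (simp add: algebra_simps)
      also have "\<dots> = ?z r * (M r p + b * M r q)"
        using fin p q by (simp add: sum.distrib algebra_simps)
      finally show ?thesis .
    qed
    have "(\<Sum>r\<in>I. \<Sum>s\<in>I. ?z r * M r s * ?z s)
        = (\<Sum>r\<in>I. (if r = p then M r p + b * M r q else 0)
                 + (if r = q then b * (M r p + b * M r q) else 0))"
      unfolding row by (intro sum.cong refl) (simp add: algebra_simps)
    also have "\<dots> = M p p + 2 * b * M p q + b\<^sup>2 * M q q"
      using fin p q sym by (simp add: sum.distrib algebra_simps power2_eq_square)
    finally have value_at_z: "(\<Sum>r\<in>I. \<Sum>s\<in>I. ?z r * M r s * ?z s)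
        = M p p + 2 * b * M p q + b\<^sup>2 * M q q" .
    have "\<forall>z. 0 \<le> (\<Sum>r\<in>I. \<Sum>s\<in>I. z r * M r s * z s)"
      using psd unfolding psd_on_def by (rule conjunct2)
    from this[rule_format, of ?z] show ?thesis unfolding value_at_z .
  qed
  show ?thesis using form[of 1] form[of "-1"] by simp
qed

section \<open>Attainment of the maximum\<close>

text \<open>
  Entries outside \<open>V \<times> V\<close> have no meaning, but they must be confined as well for the set to be
  compact in the product topology on functions of full type.
\<close>

definition theta_witnesses :: "real \<Rightarrow> ('a, 'b) pre_digraph \<Rightarrow> ('a \<Rightarrow> 'a \<Rightarrow> real) set" where
  "theta_witnesses k G = {Y. (\<forall>i j. Y i j \<in> {-1..1}) \<and>
     (\<forall>(i, j)\<in>arcs_ends G. Y i j = 0) \<and>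
     psd_on (insert None (Some ` verts G)) (bordered (\<lambda>i. Y i i) Y) \<and>
     (\<forall>i\<in>verts G. k * Y i i \<in> {0..1})}"

lemma continuous_on_matrix_entry: "continuous_on S (\<lambda>Y :: 'a \<Rightarrow> 'a \<Rightarrow> real. Y i j)"
  by (rule continuous_on_product_then_coordinatewise
      [OF continuous_on_product_then_coordinatewise[OF continuous_on_id]])

lemma compact_theta_witnesses: "compact (theta_witnesses k G)"
proof -
  let ?I = "insert None (Some ` verts G)"
  let ?B = "{Y :: 'a \<Rightarrow> 'a \<Rightarrow> real. \<forall>i j. Y i j \<in> {-1..1}}"
  let ?C = "{Y. (\<forall>i j. (i, j) \<in> arcs_ends G \<longrightarrow> Y i j = 0) \<and>
     (\<forall>p q. p \<in> ?I \<longrightarrow> q \<in> ?I \<longrightarrow>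
        bordered (\<lambda>i. Y i i) Y p q = bordered (\<lambda>i. Y i i) Y q p) \<and>
     (\<forall>z. 0 \<le> (\<Sum>p\<in>?I. \<Sum>q\<in>?I. z p * bordered (\<lambda>i. Y i i) Y p q * z q)) \<and>
     (\<forall>i. i \<in> verts G \<longrightarrow> 0 \<le> k * Y i i \<and> k * Y i i \<le> 1)}"
  have tychonoff: "compact {f :: 'a \<Rightarrow> 'c. \<forall>i. f i \<in> K}" if "compact K"
    for K :: "'c::topological_space set"
  proof -
    have "compactin (product_topology (\<lambda>_. euclidean) UNIV) (\<Pi>\<^sub>E i\<in>UNIV. K)"
      using that by (subst compactin_PiE) auto
    then show ?thesis
      by (simp add: euclidean_product_topology PiE_def Pi_def)
  qed
  \<comment> \<open>A matrix is a curried function, so its rows and then its entries are confined in turn.\<close>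
  have "compact ?B"
    using tychonoff[OF tychonoff[OF compact_Icc[of "-1::real" 1]]] by simp
  moreover have "closed ?C"
  proof -
    have bord: "continuous_on UNIV (\<lambda>Y :: 'a \<Rightarrow> 'a \<Rightarrow> real. bordered (\<lambda>i. Y i i) Y p q)" for p q
      by (cases p; cases q) (auto intro: continuous_on_matrix_entry)
    have scaled: "continuous_on UNIV (\<lambda>Y :: 'a \<Rightarrow> 'a \<Rightarrow> real. k * Y i i)" for i
      by (intro continuous_on_mult continuous_on_const continuous_on_matrix_entry)
    have form: "continuous_on UNIV (\<lambda>Y :: 'a \<Rightarrow> 'a \<Rightarrow> real.
        \<Sum>p\<in>?I. \<Sum>q\<in>?I. z p * bordered (\<lambda>i. Y i i) Y p q * z q)" for z
      by (intro continuous_on_sum continuous_on_mult continuous_on_const bord)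
    show ?thesis
      by (intro closed_Collect_conj closed_Collect_all closed_Collect_imp open_Collect_const
          closed_Collect_eq closed_Collect_le continuous_on_const
          continuous_on_matrix_entry bord scaled form)
  qed
  moreover have "theta_witnesses k G = ?B \<inter> ?C"
    unfolding theta_witnesses_def psd_on_def symmetric_on_def Ball_def split_paired_All prod.case
      atLeastAtMost_iff Collect_conj_eq[symmetric]
    by (intro Collect_cong) meson
  ultimately show ?thesis
    by (simp add: compact_Int_closed)
qed

text \<open>
  The normalisation of the corner entry to \<open>1\<close> bounds the diagonal: \<open>2 x\<^sub>h \<le> 1 + x\<^sub>h\<close>, and the diagonal
  bounds everything else.
\<close>

lemma bordered_psd_entries:
  assumes psd: "psd_on (insert None (Some ` V)) (bordered x Y)" and fin: "finite V"
    and diag: "\<And>i. i \<in> V \<Longrightarrow> Y i i = x i" and i: "i \<in> V" and j: "j \<in> V"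
  shows "\<bar>Y i j\<bar> \<le> 1"
proof -
  have finI: "finite (insert None (Some ` V))" using fin by simp
  have le1: "Y h h \<le> 1" if "h \<in> V" for h
    using psd_on_entry_bound[OF psd finI, of None "Some h"] that diag by simp
  show ?thesis
    using psd_on_entry_bound[OF psd finI, of "Some i" "Some j"] le1[OF i] le1[OF j] i j by simp
qed

text \<open>
  Compactness is available for the witness matrices, not directly for the vectors, which are only
  diagonals of them; hence the objective is transferred to the matrices.
\<close>

lemma objective_values_eq:
  assumes "graph G"
  shows "(\<lambda>x. \<Sum>i\<in>verts G. w i * x i) ` theta_body_k k G
       = (\<lambda>Y. \<Sum>i\<in>verts G. w i * (k * Y i i)) ` theta_witnesses k G"
    (is "?f ` _ = ?g ` _")
proof (intro equalityI image_subsetI)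
  interpret graph G by fact
  let ?V = "verts G" and ?I = "insert None (Some ` verts G)"
  fix y assume "y \<in> theta_body_k k G"
  then obtain x Y where y: "y = (\<lambda>i\<in>?V. k * x i)" "y \<in> ?V \<rightarrow>\<^sub>E {0..1}"
    and Y: "\<forall>i\<in>?V. Y i i = x i" "\<forall>(i, j)\<in>arcs_ends G. Y i j = 0" "psd_on ?I (bordered x Y)"
    unfolding theta_body_k_def theta_body_def by auto
  define Z where "Z i j = (if i \<in> ?V \<and> j \<in> ?V then Y i j else 0)" for i j
  have "\<bar>Y i j\<bar> \<le> 1" if "i \<in> ?V" "j \<in> ?V" for i j
    using bordered_psd_entries[OF Y(3) finite_verts] Y(1) that by simp
  then have "\<forall>i j. Z i j \<in> {-1..1}"
    by (auto simp: Z_def abs_le_iff minus_le_iff)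
  moreover have "\<forall>(i, j)\<in>arcs_ends G. Z i j = 0"
    using Y(2) by (auto simp: Z_def)
  moreover have "psd_on ?I (bordered (\<lambda>i. Z i i) Z)"
  proof -
    have "bordered (\<lambda>i. Z i i) Z p q = bordered x Y p q" if "p \<in> ?I" "q \<in> ?I" for p q
      using that Y(1) by (auto simp: Z_def)
    then show ?thesis
      using Y(3) psd_on_cong[of ?I "bordered (\<lambda>i. Z i i) Z" "bordered x Y"] by blast
  qed
  moreover have "\<forall>i\<in>?V. k * Z i i \<in> {0..1}"
    using y Y(1) by (auto simp: Z_def PiE_iff)
  ultimately have "Z \<in> theta_witnesses k G"
    unfolding theta_witnesses_def by simp
  moreover have "?f y = ?g Z"
    using y(1) Y(1) by (auto simp: Z_def intro: sum.cong)
  ultimately show "?f y \<in> ?g ` theta_witnesses k G" by blast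
next
  let ?V = "verts G" and ?I = "insert None (Some ` verts G)"
  fix Y assume Y: "Y \<in> theta_witnesses k G"
  define x where "x = (\<lambda>i\<in>?V. Y i i)"
  have psd: "psd_on ?I (bordered (\<lambda>i. Y i i) Y)"
    using Y by (simp add: theta_witnesses_def)
  have "bordered x Y p q = bordered (\<lambda>i. Y i i) Y p q" if "p \<in> ?I" "q \<in> ?I" for p q
    using that by (auto simp: x_def)
  then have "psd_on ?I (bordered x Y)"
    using psd psd_on_cong[of ?I "bordered x Y" "bordered (\<lambda>i. Y i i) Y"] by blast
  moreover have "symmetric_on ?V Y"
    using psd unfolding psd_on_def symmetric_on_def by auto
  ultimately have "x \<in> theta_body G"
    using Y unfolding theta_body_def theta_witnesses_def x_def by auto
  moreover have "(\<lambda>i\<in>?V. k * x i) \<in> ?V \<rightarrow>\<^sub>E {0..1}"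
    using Y by (auto simp: theta_witnesses_def x_def)
  ultimately have "(\<lambda>i\<in>?V. k * x i) \<in> theta_body_k k G"
    unfolding theta_body_k_def by blast
  moreover have "?g Y = ?f (\<lambda>i\<in>?V. k * x i)"
    by (auto simp: x_def intro: sum.cong)
  ultimately show "?g Y \<in> ?f ` theta_body_k k G" by blast
qed

text \<open>
  The operator \<open>GREATEST\<close> is meaningful only for a set that has a greatest element; a nonempty
  compact set of reals does.
\<close>

lemma theta_upper_bound:
  assumes "graph G" and y: "y \<in> theta_body_k k G"
  shows "(\<Sum>i\<in>verts G. w i * y i) \<le> theta k G w"
proof -
  let ?f = "\<lambda>x. \<Sum>i\<in>verts G. w i * x i"
  let ?S = "?f ` theta_body_k k G"
  have "continuous_on (theta_witnesses k G) (\<lambda>Y. \<Sum>i\<in>verts G. w i * (k * Y i i))"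
    by (intro continuous_on_sum continuous_on_mult continuous_on_const continuous_on_matrix_entry)
  then have "compact ?S"
    unfolding objective_values_eq[OF assms(1)]
    by (intro compact_continuous_image compact_theta_witnesses)
  moreover have "?f y \<in> ?S" using y by blast
  ultimately obtain m where m: "m \<in> ?S" "\<forall>s\<in>?S. s \<le> m"
    using compact_attains_sup[of ?S] by blast
  then have "theta k G w = m"
    unfolding theta_def by (intro Greatest_equality) auto
  then show ?thesis using m(2) \<open>?f y \<in> ?S\<close> by blast
qed

section \<open>Colourable sets are feasible\<close>

text \<open>
  The square matrix of the averaged class indicators has entry \<open>1/k\<close> exactly at the pairs of equally
  coloured vertices of \<open>U\<close>; the summands \<open>(1/k) (1, \<chi>\<^sub>t) (1, \<chi>\<^sub>t)\<^sup>T\<close> of its bordered version add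
  up to \<open>1\<close> in the corner because there are \<open>k\<close> of them, empty classes included.
\<close>

lemma indicator_in_theta_body_k:
  assumes U: "U \<subseteq> verts G" and col: "k_colorable k (G \<restriction> U)" and k: "k \<ge> 1"
  shows "(\<lambda>i\<in>verts G. if i \<in> U then 1 else 0) \<in> theta_body_k (real k) G"
proof -
  let ?V = "verts G"
  obtain c where c: "\<And>i. i \<in> U \<Longrightarrow> c i < k"
      and proper: "\<And>i j. (i, j) \<in> arcs_ends (G \<restriction> U) \<Longrightarrow> c i \<noteq> c j"
    using col unfolding k_colorable_def by fastforce
  define x where "x = (\<lambda>i\<in>?V. if i \<in> U then 1 / real k else 0)"
  define Y where "Y i j = (if i \<in> U \<and> j \<in> U \<and> c i = c j then 1 / real k else 0)" for i j
  \<comment> \<open>\<open>v t\<close> is the vector \<open>(1, \<chi>\<^sub>t)\<close>.\<close>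
  define v :: "nat \<Rightarrow> 'a option \<Rightarrow> real" where
    "v t p = (case p of None \<Rightarrow> 1 | Some i \<Rightarrow> if i \<in> U \<and> c i = t then 1 else 0)" for t p
  have "psd_on (insert None (Some ` ?V)) (bordered x Y)"
  proof (rule psd_on_sum_rank_one)
    fix p q assume "p \<in> insert None (Some ` ?V)" "q \<in> insert None (Some ` ?V)"
    moreover have "(\<Sum>t<k. (if i \<in> U \<and> c i = t then 1 else 0) / real k)
        = (if i \<in> U then 1 / real k else 0)" for i
      using c[of i] by (cases "i \<in> U") (simp_all flip: sum_divide_distrib)
    moreover have "(\<Sum>t<k. (if i \<in> U \<and> c i = t then 1 else 0)
        * (if j \<in> U \<and> c j = t then 1 else 0) / real k) = Y i j" for i j
    proof -
      have "(\<Sum>t<k. (if i \<in> U \<and> c i = t then 1 else 0)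
          * (if j \<in> U \<and> c j = t then 1 else 0) / real k)
        = (\<Sum>t<k. if t = c i then Y i j else 0)"
        by (intro sum.cong) (auto simp: Y_def)
      then show ?thesis using c[of i] by (auto simp: Y_def)
    qed
    ultimately show "bordered x Y p q = (\<Sum>t<k. 1 / real k * (v t p * v t q))"
      using k by (cases p; cases q) (auto simp: v_def x_def)
  qed simp
  moreover have "Y i j = 0" if "(i, j) \<in> arcs_ends G" for i j
  proof -
    have "(i, j) \<in> arcs_ends (G \<restriction> U)" if "i \<in> U" "j \<in> U"
      using that \<open>(i, j) \<in> arcs_ends G\<close> by (auto simp: arcs_ends_def arc_to_ends_def)
    then show ?thesis using proper by (auto simp: Y_def)
  qed
  moreover have "symmetric_on ?V Y" by (auto simp: symmetric_on_def Y_def)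
  moreover have "\<forall>i\<in>?V. Y i i = x i" by (simp add: Y_def x_def)
  moreover have "x \<in> ?V \<rightarrow>\<^sub>E UNIV" by (simp add: x_def)
  ultimately have "x \<in> theta_body G"
    unfolding theta_body_def by blast
  moreover have "(\<lambda>i\<in>?V. if i \<in> U then 1 else 0) = (\<lambda>i\<in>?V. real k * x i)"
    using k by (auto simp: x_def)
  moreover have "(\<lambda>i\<in>?V. if i \<in> U then 1 else 0) \<in> ?V \<rightarrow>\<^sub>E {0..1 :: real}"
    by auto
  ultimately show ?thesis
    unfolding theta_body_k_def by blast
qed

theorem proposition19:
  fixes G :: "('a, 'b) pre_digraph" and k :: nat and w :: "'a \<Rightarrow> real"
  assumes "graph G"
    and "k \<ge> 1"
    and "w \<in> verts G \<rightarrow>\<^sub>E {0..}"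
  shows "alpha k G w \<le> theta (real k) G w"
proof -
  interpret graph G by fact
  let ?\<U> = "{U. U \<subseteq> verts G \<and> k_colorable k (G \<restriction> U)}"
  have "k_colorable k (G \<restriction> {})"
    by (auto simp: k_colorable_def arcs_ends_def)
  then have "?\<U> \<noteq> {}" by blast
  moreover have "finite ?\<U>" by simp
  moreover have "(\<Sum>i\<in>U. w i) \<le> theta (real k) G w" if "U \<in> ?\<U>" for U
  proof -
    have "(\<Sum>i\<in>U. w i) = (\<Sum>i\<in>verts G. w i * (\<lambda>i\<in>verts G. if i \<in> U then 1 else 0) i)"
      using that by (intro sum.mono_neutral_cong_left) auto
    also have "\<dots> \<le> theta (real k) G w"
      using that assms(2)
      by (intro theta_upper_bound[OF assms(1)] indicator_in_theta_body_k) auto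
    finally show ?thesis .
  qed
  ultimately show ?thesis
    unfolding alpha_def by (auto simp: setcompr_eq_image)
qed

end
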